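(* Let $(\mathcal{A},\mu_{A,0},\alpha_A)$ and $(\mathcal{B},\mu_{B,0},\alpha_B)$ be multiplicative Hom-associative algebras over $\mathbb{K}$ and $\phi:\mathcal{A}\to\mathcal{B}$ a Hom-associative algebra morphism. If $H^3_{Hom}(\phi,\phi)=0$, then every infinitesimal deformation of $\phi$ (i.e. deformation of order $1$) can be extended to a formal deformation of $\phi$ of larger order.
   Context: $\mathbb{K}$ is an algebraically closed field of characteristic $0$. A Hom-associative algebra $(\mathcal{A},\mu,\alpha)$ is a vector space with a bilinear map $\mu$ and a linear map $\alpha$ such that $\mu(\alpha(x),\mu(y,z))=\mu(\mu(x,y),\alpha(z))$; it is multiplicative if $\alpha\circ\mu=\mu\circ(\alpha\otimes\alpha)$. A morphism $\phi:\mathcal{A}\to\mathcal{B}$ is a linear map with $\mu_{B,0}\circ(\phi\otimes\phi)=\phi\circ\mu_{A,0}$ and $\phi\circ\alpha_A=\alpha_B\circ\phi$. Cohomology: for $n\ge1$, $C^n_{\alpha_A,\alpha_B}(\mathcal{A},\mathcal{B})$ is the space of $n$-linear maps $f:\mathcal{A}^{\times n}\to\mathcal{B}$ with $\alpha_B(f(u_1,\dots,u_n))=f(\alpha_A(u_1),\dots,\alpha_A(u_n))$, with $$\delta^n_{Hom}\varphi(x_0,\dots,x_n)=\mu_{B,0}(\phi(\alpha_A^{n-1}(x_0)),\varphi(x_1,\dots,x_n))+\sum_{k=1}^n(-1)^k\varphi(\alpha_A(x_0),\dots,\alpha_A(x_{k-2}),\mu_{A,0}(x_{k-1},x_k),\alpha_A(x_{k+1}),\dots,\alpha_A(x_n))+(-1)^{n+1}\mu_{B,0}(\varphi(x_0,\dots,x_{n-1}),\phi(\alpha_A^{n-1}(x_n))).$$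 $C^n_{Hom}(\mathcal{A},\mathcal{A})$ and $C^n_{Hom}(\mathcal{B},\mathcal{B})$ with their $\delta^n_{Hom}$ are the case $\phi=\mathrm{id}$. For $n\ge2$, $C^n_{Hom}(\phi,\phi)=C^n_{Hom}(\mathcal{A},\mathcal{A})\times C^n_{Hom}(\mathcal{B},\mathcal{B})\times C^{n-1}_{\alpha_A,\alpha_B}(\mathcal{A},\mathcal{B})$ and $\delta^n(\varphi_1,\varphi_2,\varphi_3)=(\delta^n_{Hom}\varphi_1,\delta^n_{Hom}\varphi_2,\phi\circ\varphi_1-\varphi_2\circ\phi^{\otimes n}-\delta^{n-1}_{Hom}\varphi_3)$. $H^3_{Hom}(\phi,\phi)=\ker\delta^3/\mathrm{im}\,\delta^2$. Deformations of order $N$: a triple $\Theta_t=(\mu_{A,t},\mu_{B,t},\phi_t)$ with $\mu_{A,t}=\sum_{i=0}^N\mu_{A,i}t^i$, $\mu_{B,t}=\sum_{i=0}^N\mu_{B,i}t^i$, $\phi_t=\sum_{i=0}^N\phi_it^i$, $\phi_0=\phi$, where $\mu_{A,i}$, $\mu_{B,i}$ are bilinear maps on $\mathcal{A}$, $\mathcal{B}$ commuting with $\alpha_A$, $\alpha_B$ respectively, $\phi_i:\mathcal{A}\to\mathcal{B}$ are linear with $\phi_i\circ\alpha_A=\alpha_B\circ\phi_i$, such that for every $0\le n\le N$: $\sum_{i+j=n}\big(\mu_{A,i}(\mu_{A,j}(x,y),\alpha_A(z))-\mu_{A,i}(\alpha_A(x),\mu_{A,j}(y,z))\big)=0$, the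 same for $\mathcal{B}$, and $\sum_{i=0}^n\phi_i(\mu_{A,n-i}(a,b))=\sum_{i+j+k=n}\mu_{B,i}(\phi_j(a),\phi_k(b))$. An infinitesimal deformation is one of order $N=1$. An extension of an order $N$ deformation $\Theta_t$ to a larger order $N'>N$ is a deformation of order $N'$ whose coefficients of $t^0,\dots,t^N$ coincide with those of $\Theta_t$. *)

theory Defs
  imports
    "HOL-Computational_Algebra.Computational_Algebra"
    "HOL-Library.Function_Algebras"
    "HOL-Library.Product_Plus"
    "HOL-Library.Set_Algebras"
begin

record ('k, 'a) hom_alg =
  hscale :: "'k \<Rightarrow> 'a \<Rightarrow> 'a"
  hmul :: "'a \<Rightarrow> 'a \<Rightarrow> 'a"
  twist :: "'a \<Rightarrow> 'a"

definition bilinear_op :: "('k::field, 'a::ab_group_add) hom_alg \<Rightarrow> ('a \<Rightarrow> 'a \<Rightarrow> 'a) \<Rightarrow> bool" where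
  "bilinear_op A m \<longleftrightarrow>
     (\<forall>x. Vector_Spaces.linear (hscale A) (hscale A) (\<lambda>y. m x y)) \<and>
     (\<forall>y. Vector_Spaces.linear (hscale A) (hscale A) (\<lambda>x. m x y))"

definition hom_associative :: "('k::field, 'a::ab_group_add) hom_alg \<Rightarrow> bool" where
  "hom_associative A \<longleftrightarrow>
     vector_space (hscale A) \<and>
     bilinear_op A (hmul A) \<and>
     Vector_Spaces.linear (hscale A) (hscale A) (twist A) \<and>
     (\<forall>x y z. hmul A (twist A x) (hmul A y z) = hmul A (hmul A x y) (twist A z))"

definition multiplicative :: "('k::field, 'a::ab_group_add) hom_alg \<Rightarrow> bool" where
  "multiplicative A \<longleftrightarrow> (\<forall>x y. twist A (hmul A x y) = hmul A (twist A x) (twist A y))"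

definition hom_alg_morphism ::
  "('k::field, 'a::ab_group_add) hom_alg \<Rightarrow> ('k, 'b::ab_group_add) hom_alg \<Rightarrow> ('a \<Rightarrow> 'b) \<Rightarrow> bool" where
  "hom_alg_morphism A B \<phi> \<longleftrightarrow>
     Vector_Spaces.linear (hscale A) (hscale B) \<phi> \<and>
     (\<forall>x y. hmul B (\<phi> x) (\<phi> y) = \<phi> (hmul A x y)) \<and>
     \<phi> \<circ> twist A = twist B \<circ> \<phi>"

text \<open>An \<open>n\<close>-linear map takes its arguments as a list of length \<open>n\<close> and is required to vanish on
  lists of any other length, so that equality and addition of such maps are those of HOL functions.\<close>

definition multilinear_map ::
  "('k::field, 'a::ab_group_add) hom_alg \<Rightarrow> ('k, 'b::ab_group_add) hom_alg \<Rightarrow> nat \<Rightarrow> ('a list \<Rightarrow> 'b) \<Rightarrow> bool" where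
  "multilinear_map A B n f \<longleftrightarrow>
     (\<forall>xs. length xs \<noteq> n \<longrightarrow> f xs = 0) \<and>
     (\<forall>xs i. length xs = n \<longrightarrow> i < n \<longrightarrow>
        Vector_Spaces.linear (hscale A) (hscale B) (\<lambda>x. f (xs[i := x])))"

definition cochains ::
  "('k::field, 'a::ab_group_add) hom_alg \<Rightarrow> ('k, 'b::ab_group_add) hom_alg \<Rightarrow> nat \<Rightarrow> ('a list \<Rightarrow> 'b) set" where
  "cochains A B n =
     {f. multilinear_map A B n f \<and>
         (\<forall>xs. length xs = n \<longrightarrow> twist B (f xs) = f (map (twist A) xs))}"

definition hom_delta ::
  "('k::field, 'a::ab_group_add) hom_alg \<Rightarrow> ('k, 'b::ab_group_add) hom_alg \<Rightarrow> ('a \<Rightarrow> 'b) \<Rightarrow> nat \<Rightarrow>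
   ('a list \<Rightarrow> 'b) \<Rightarrow> 'a list \<Rightarrow> 'b" where
  "hom_delta A B \<phi> n f xs =
     (if length xs = n + 1 then
        hmul B (\<phi> ((twist A ^^ (n - 1)) (hd xs))) (f (tl xs))
        + (\<Sum>k = 1..n. hscale B ((-1) ^ k)
             (f (map (twist A) (take (k - 1) xs)
                 @ [hmul A (xs ! (k - 1)) (xs ! k)]
                 @ map (twist A) (drop (k + 1) xs))))
        + hscale B ((-1) ^ (n + 1))
            (hmul B (f (butlast xs)) (\<phi> ((twist A ^^ (n - 1)) (last xs))))
      else 0)"

text \<open>The cochain complex of the morphism \<open>\<phi>\<close>, in degrees \<open>n \<ge> 2\<close>; addition and zero of triples of
  cochains are the componentwise and pointwise ones.\<close>

type_synonym ('a, 'b) mor_cochain = "('a list \<Rightarrow> 'a) \<times> ('b list \<Rightarrow> 'b) \<times> ('a list \<Rightarrow> 'b)"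

definition mor_cochains ::
  "('k::field, 'a::ab_group_add) hom_alg \<Rightarrow> ('k, 'b::ab_group_add) hom_alg \<Rightarrow> nat \<Rightarrow>
   ('a, 'b) mor_cochain set" where
  "mor_cochains A B n = cochains A A n \<times> cochains B B n \<times> cochains A B (n - 1)"

definition mor_delta ::
  "('k::field, 'a::ab_group_add) hom_alg \<Rightarrow> ('k, 'b::ab_group_add) hom_alg \<Rightarrow> ('a \<Rightarrow> 'b) \<Rightarrow> nat \<Rightarrow>
   ('a, 'b) mor_cochain \<Rightarrow> ('a, 'b) mor_cochain" where
  "mor_delta A B \<phi> n = (\<lambda>(f\<^sub>1, f\<^sub>2, f\<^sub>3).
     (hom_delta A A id n f\<^sub>1,
      hom_delta B B id n f\<^sub>2,
      (\<phi> \<circ> f\<^sub>1) - (f\<^sub>2 \<circ> map \<phi>) - hom_delta A B \<phi> (n - 1) f\<^sub>3))"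

definition mor_cocycles ::
  "('k::field, 'a::ab_group_add) hom_alg \<Rightarrow> ('k, 'b::ab_group_add) hom_alg \<Rightarrow> ('a \<Rightarrow> 'b) \<Rightarrow> nat \<Rightarrow>
   ('a, 'b) mor_cochain set" where
  "mor_cocycles A B \<phi> n = {c \<in> mor_cochains A B n. mor_delta A B \<phi> n c = 0}"

definition mor_coboundaries ::
  "('k::field, 'a::ab_group_add) hom_alg \<Rightarrow> ('k, 'b::ab_group_add) hom_alg \<Rightarrow> ('a \<Rightarrow> 'b) \<Rightarrow> nat \<Rightarrow>
   ('a, 'b) mor_cochain set" where
  "mor_coboundaries A B \<phi> n = mor_delta A B \<phi> (n - 1) ` mor_cochains A B (n - 1)"

text \<open>For \<open>n \<ge> 3\<close>, the quotient of cocycles by coboundaries as a set of cosets. Its zero element is the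
  coset \<open>mor_coboundaries A B \<phi> n\<close>, so the cohomology vanishes iff this is the only coset.\<close>

definition mor_cohomology ::
  "('k::field, 'a::ab_group_add) hom_alg \<Rightarrow> ('k, 'b::ab_group_add) hom_alg \<Rightarrow> ('a \<Rightarrow> 'b) \<Rightarrow> nat \<Rightarrow>
   ('a, 'b) mor_cochain set set" where
  "mor_cohomology A B \<phi> n = (\<lambda>z. z +o mor_coboundaries A B \<phi> n) ` mor_cocycles A B \<phi> n"

definition mor_cohomology_vanishes ::
  "('k::field, 'a::ab_group_add) hom_alg \<Rightarrow> ('k, 'b::ab_group_add) hom_alg \<Rightarrow> ('a \<Rightarrow> 'b) \<Rightarrow> nat \<Rightarrow> bool" where
  "mor_cohomology_vanishes A B \<phi> n \<longleftrightarrow> mor_cohomology A B \<phi> n = {mor_coboundaries A B \<phi> n}"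

text \<open>A triple of polynomials in \<open>t\<close> is given by its coefficient sequences, which vanish beyond the
  order \<open>N\<close>.\<close>

type_synonym ('a, 'b) coeff_triple =
  "(nat \<Rightarrow> 'a \<Rightarrow> 'a \<Rightarrow> 'a) \<times> (nat \<Rightarrow> 'b \<Rightarrow> 'b \<Rightarrow> 'b) \<times> (nat \<Rightarrow> 'a \<Rightarrow> 'b)"

definition mult_deformation ::
  "('k::field, 'a::ab_group_add) hom_alg \<Rightarrow> nat \<Rightarrow> (nat \<Rightarrow> 'a \<Rightarrow> 'a \<Rightarrow> 'a) \<Rightarrow> bool" where
  "mult_deformation A N m \<longleftrightarrow>
     m 0 = hmul A \<and>
     (\<forall>i > N. m i = 0) \<and>
     (\<forall>i \<le> N. bilinear_op A (m i) \<and>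
        (\<forall>x y. twist A (m i x y) = m i (twist A x) (twist A y))) \<and>
     (\<forall>n \<le> N. \<forall>x y z.
        (\<Sum>(i, j) \<in> {(i, j). i + j = n}.
           m i (m j x y) (twist A z) - m i (twist A x) (m j y z)) = 0)"

definition deformation ::
  "('k::field, 'a::ab_group_add) hom_alg \<Rightarrow> ('k, 'b::ab_group_add) hom_alg \<Rightarrow> ('a \<Rightarrow> 'b) \<Rightarrow> nat \<Rightarrow>
   ('a, 'b) coeff_triple \<Rightarrow> bool" where
  "deformation A B \<phi> N = (\<lambda>(m\<^sub>A, m\<^sub>B, p).
     mult_deformation A N m\<^sub>A \<and>
     mult_deformation B N m\<^sub>B \<and>
     p 0 = \<phi> \<and>
     (\<forall>i > N. p i = 0) \<and>
     (\<forall>i \<le> N. Vector_Spaces.linear (hscale A) (hscale B) (p i) \<and> p i \<circ> twist A = twist B \<circ> p i) \<and>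
     (\<forall>n \<le> N. \<forall>a b.
        (\<Sum>i = 0..n. p i (m\<^sub>A (n - i) a b)) =
        (\<Sum>(i, j, k) \<in> {(i, j, k). i + j + k = n}. m\<^sub>B i (p j a) (p k b))))"

definition infinitesimal_deformation ::
  "('k::field, 'a::ab_group_add) hom_alg \<Rightarrow> ('k, 'b::ab_group_add) hom_alg \<Rightarrow> ('a \<Rightarrow> 'b) \<Rightarrow>
   ('a, 'b) coeff_triple \<Rightarrow> bool" where
  "infinitesimal_deformation A B \<phi> \<Theta> \<longleftrightarrow> deformation A B \<phi> 1 \<Theta>"

definition is_extension ::
  "('k::field, 'a::ab_group_add) hom_alg \<Rightarrow> ('k, 'b::ab_group_add) hom_alg \<Rightarrow> ('a \<Rightarrow> 'b) \<Rightarrow>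
   nat \<Rightarrow> ('a, 'b) coeff_triple \<Rightarrow> nat \<Rightarrow> ('a, 'b) coeff_triple \<Rightarrow> bool" where
  "is_extension A B \<phi> N \<Theta> N' \<Theta>' \<longleftrightarrow>
     N < N' \<and> deformation A B \<phi> N' \<Theta>' \<and>
     (\<forall>i \<le> N. fst \<Theta>' i = fst \<Theta> i \<and>
               fst (snd \<Theta>') i = fst (snd \<Theta>) i \<and>
               snd (snd \<Theta>') i = snd (snd \<Theta>) i)"

end

(* The t^2-coefficients of the deformation equations say that the second-order terms
   (m_2, n_2, p_2) have coboundary equal to a triple Ob that is quadratic in the first-order terms.
   The first-order equations, substituted into themselves, show that Ob is a 3-cocycle of the complex
   of phi. If H^3 vanishes, Ob is a coboundary and the required second-order terms exist. *)

theory Submission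
  imports Defs
begin

section \<open>Obstruction identities in abelian groups with biadditive products\<close>

definition biadditive :: "('a::ab_group_add \<Rightarrow> 'b::ab_group_add \<Rightarrow> 'c::ab_group_add) \<Rightarrow> bool" where
  "biadditive m \<longleftrightarrow> (\<forall>x. Modules.additive (m x)) \<and> (\<forall>y. Modules.additive (\<lambda>x. m x y))"

lemma biadditiveD:
  assumes "biadditive m"
  shows "m (x + x') y = m x y + m x' y" "m x (y + y') = m x y + m x y'"
    "m (x - x') y = m x y - m x' y" "m x (y - y') = m x y - m x y'"
    "m (- x) y = - m x y" "m x (- y) = - m x y"
    "m 0 y = 0" "m x 0 = 0"
proof -
  interpret L: Modules.additive "\<lambda>x. m x y" for y
    using assms by (simp add: biadditive_def)
  interpret R: Modules.additive "m x" for x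
    using assms by (simp add: biadditive_def)
  show "m (x + x') y = m x y + m x' y" "m x (y + y') = m x y + m x y'"
    "m (x - x') y = m x y - m x' y" "m x (y - y') = m x y - m x y'"
    "m (- x) y = - m x y" "m x (- y) = - m x y"
    "m 0 y = 0" "m x 0 = 0"
    by (rule L.add R.add L.diff R.diff L.minus R.minus L.zero R.zero)+
qed

lemma linear_additive:
  assumes "Vector_Spaces.linear s t f"
  shows "Modules.additive f"
  using assms by (simp add: Vector_Spaces.linear_iff Modules.additive_def)

text \<open>Forgets the scalars: the cocycle identities are computations in abelian groups with
  biadditive products.\<close>

lemma bilinear_op_biadditive: "bilinear_op A m \<Longrightarrow> biadditive m"
  unfolding bilinear_op_def biadditive_def by (blast intro: linear_additive)

text \<open>The polarised Hom-associator. Taking two products makes the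
  \<open>t\<close>-coefficients of Hom-associativity sums of
  \<open>hom_associator \<alpha> (m i) (m j)\<close> over \<open>i + j = n\<close>: the mixed terms
  give the first-order equation, the diagonal one gives the obstruction.\<close>

definition hom_associator ::
  "('a::ab_group_add \<Rightarrow> 'a) \<Rightarrow> ('a \<Rightarrow> 'a \<Rightarrow> 'a) \<Rightarrow> ('a \<Rightarrow> 'a \<Rightarrow> 'a) \<Rightarrow> 'a \<Rightarrow> 'a \<Rightarrow> 'a \<Rightarrow> 'a" where
  "hom_associator \<alpha> m m' x y z = m (m' x y) (\<alpha> z) - m (\<alpha> x) (m' y z)"

text \<open>A Hom-analogue of the graded Jacobi identity for the Gerstenhaber bracket: the
  differential of the associator of \<open>m\<close> is a signed sum of insertions of
  \<open>m\<close> into the first-order defect and of that defect into \<open>m\<close>, and the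
  defect is zero.\<close>

lemma hom_associator_cocycle:
  fixes \<mu> m :: "'a::ab_group_add \<Rightarrow> 'a \<Rightarrow> 'a"
  assumes "biadditive \<mu>" "biadditive m"
    and mult: "\<And>x y. \<alpha> (\<mu> x y) = \<mu> (\<alpha> x) (\<alpha> y)" "\<And>x y. \<alpha> (m x y) = m (\<alpha> x) (\<alpha> y)"
    and first: "\<And>x y z. hom_associator \<alpha> \<mu> m x y z + hom_associator \<alpha> m \<mu> x y z = 0"
  shows "\<mu> (\<alpha> (\<alpha> x)) (hom_associator \<alpha> m m y z w) - hom_associator \<alpha> m m (\<mu> x y) (\<alpha> z) (\<alpha> w)
    + hom_associator \<alpha> m m (\<alpha> x) (\<mu> y z) (\<alpha> w) - hom_associator \<alpha> m m (\<alpha> x) (\<alpha> y) (\<mu> z w)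
    + \<mu> (hom_associator \<alpha> m m x y z) (\<alpha> (\<alpha> w)) = 0" (is "?L = 0")
proof -
  define D where "D x y z = hom_associator \<alpha> \<mu> m x y z + hom_associator \<alpha> m \<mu> x y z" for x y z
  \<comment> \<open>Holds for arbitrary equivariant \<open>\<mu>\<close> and \<open>m\<close>;
    \<open>first\<close> enters only afterwards. Multiplicativity matches terms such as
    \<open>m (\<alpha> (\<mu> x y)) (m (\<alpha> z) (\<alpha> w))\<close> that arise in different
    shapes.\<close>
  have "?L = D (m x y) (\<alpha> z) (\<alpha> w) - D (\<alpha> x) (m y z) (\<alpha> w) + D (\<alpha> x) (\<alpha> y) (m z w)
      - m (D x y z) (\<alpha> (\<alpha> w)) - m (\<alpha> (\<alpha> x)) (D y z w)"
    by (simp add: D_def hom_associator_def mult biadditiveD[OF assms(1)] biadditiveD[OF assms(2)]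
        algebra_simps)
  also have "D = (\<lambda>x y z. 0)"
    by (simp add: D_def first fun_eq_iff)
  finally show ?thesis
    by (simp add: biadditiveD[OF assms(2)])
qed

text \<open>The part of the \<open>t^2\<close>-coefficient of \<nu>_t(\<phi>_t a, \<phi>_t b) -
  \<phi>_t(\<mu>_t(a, b)) that involves no second-order unknown.\<close>

definition morphism_obstruction ::
  "('a \<Rightarrow> 'a \<Rightarrow> 'a) \<Rightarrow> ('b::ab_group_add \<Rightarrow> 'b \<Rightarrow> 'b) \<Rightarrow> ('b \<Rightarrow> 'b \<Rightarrow> 'b) \<Rightarrow> ('a \<Rightarrow> 'b) \<Rightarrow> ('a \<Rightarrow> 'b)
    \<Rightarrow> 'a \<Rightarrow> 'a \<Rightarrow> 'b" where
  "morphism_obstruction m \<nu> n \<phi> p a b = n (p a) (\<phi> b) + n (\<phi> a) (p b) + \<nu> (p a) (p b) - p (m a b)"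

text \<open>The right side is the degree-2 \<open>hom_delta\<close> of \<open>Ob\<close>, so this
  makes the third component of \<open>mor_delta\<close> vanish on the obstruction triple.\<close>

lemma morphism_obstruction_cocycle:
  fixes \<mu> m :: "'a::ab_group_add \<Rightarrow> 'a \<Rightarrow> 'a" and \<nu> n :: "'b::ab_group_add \<Rightarrow> 'b \<Rightarrow> 'b"
  assumes bi: "biadditive \<nu>" "biadditive n"
    and add: "Modules.additive \<phi>" "Modules.additive p"
    and comm: "\<And>x. \<phi> (\<alpha> x) = \<beta> (\<phi> x)" "\<And>x. p (\<alpha> x) = \<beta> (p x)"
    and mor: "\<And>x y. \<phi> (\<mu> x y) = \<nu> (\<phi> x) (\<phi> y)"
    and assoc: "\<And>x y z. hom_associator \<beta> \<nu> \<nu> x y z = 0"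
    and firstA: "\<And>x y z. hom_associator \<alpha> \<mu> m x y z + hom_associator \<alpha> m \<mu> x y z = 0"
    and firstB: "\<And>x y z. hom_associator \<beta> \<nu> n x y z + hom_associator \<beta> n \<nu> x y z = 0"
    and firstp: "\<And>x y. \<phi> (m x y) + p (\<mu> x y) = n (\<phi> x) (\<phi> y) + \<nu> (p x) (\<phi> y) + \<nu> (\<phi> x) (p y)"
  defines "Ob \<equiv> morphism_obstruction m \<nu> n \<phi> p"
  shows "\<phi> (hom_associator \<alpha> m m x y z) - hom_associator \<beta> n n (\<phi> x) (\<phi> y) (\<phi> z)
     = \<nu> (\<phi> (\<alpha> x)) (Ob y z) - Ob (\<mu> x y) (\<alpha> z) + Ob (\<alpha> x) (\<mu> y z) - \<nu> (Ob x y) (\<phi> (\<alpha> z))"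
    (is "?L = ?R")
proof -
  note dist = biadditiveD[OF bi(1)] biadditiveD[OF bi(2)]
    additive.add[OF add(1)] additive.add[OF add(2)]
    additive.diff[OF add(1)] additive.diff[OF add(2)]
  define DA where "DA = hom_associator \<alpha> \<mu> m x y z + hom_associator \<alpha> m \<mu> x y z"
  define DB where "DB x y z = hom_associator \<beta> \<nu> n x y z + hom_associator \<beta> n \<nu> x y z" for x y z
  define E where "E x y = \<phi> (m x y) + p (\<mu> x y) - n (\<phi> x) (\<phi> y) - \<nu> (p x) (\<phi> y) - \<nu> (\<phi> x) (p y)"
    for x y
  \<comment> \<open>This is the \<open>t\<^sup>2\<close>-coefficient of the expansion of \<open>\<phi>\<^sub>t\<close> applied to the associator of
    \<open>\<mu>\<^sub>t\<close> through the defect \<open>\<phi>\<^sub>t \<circ> \<mu>\<^sub>t - \<nu>\<^sub>t \<circ> (\<phi>\<^sub>t \<otimes> \<phi>\<^sub>t)\<close>.\<close>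
  have "?L - ?R = - p DA
      + (E (m x y) (\<alpha> z) + n (E x y) (\<phi> (\<alpha> z)) + \<nu> (E x y) (p (\<alpha> z)))
      - (E (\<alpha> x) (m y z) + n (\<phi> (\<alpha> x)) (E y z) + \<nu> (p (\<alpha> x)) (E y z))
      + DB (p x) (\<phi> y) (\<phi> z) + DB (\<phi> x) (p y) (\<phi> z) + DB (\<phi> x) (\<phi> y) (p z)
      + hom_associator \<beta> \<nu> \<nu> (p x) (p y) (\<phi> z) + hom_associator \<beta> \<nu> \<nu> (p x) (\<phi> y) (p z)
      + hom_associator \<beta> \<nu> \<nu> (\<phi> x) (p y) (p z)"
    by (simp add: DA_def DB_def E_def Ob_def morphism_obstruction_def hom_associator_def comm mor
        dist algebra_simps)
  moreover have "DA = 0" "DB = (\<lambda>x y z. 0)" "E = (\<lambda>x y. 0)"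
    by (simp_all add: DA_def DB_def E_def firstA firstB firstp fun_eq_iff)
  ultimately have "?L - ?R = 0"
    by (simp add: assoc dist additive.zero[OF add(2)])
  then show ?thesis by simp
qed

section \<open>Cochains and differentials in low degree\<close>

definition cochain2 :: "('a \<Rightarrow> 'a \<Rightarrow> 'b) \<Rightarrow> 'a list \<Rightarrow> 'b::zero" where
  "cochain2 g xs = (if length xs = 2 then g (xs ! 0) (xs ! 1) else 0)"

definition cochain3 :: "('a \<Rightarrow> 'a \<Rightarrow> 'a \<Rightarrow> 'b) \<Rightarrow> 'a list \<Rightarrow> 'b::zero" where
  "cochain3 g xs = (if length xs = 3 then g (xs ! 0) (xs ! 1) (xs ! 2) else 0)"

lemma length_2_conv: "length xs = 2 \<longleftrightarrow> (\<exists>x y. xs = [x, y])"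
  by (auto simp: eval_nat_numeral length_Suc_conv)

lemma length_3_conv: "length xs = 3 \<longleftrightarrow> (\<exists>x y z. xs = [x, y, z])"
  by (auto simp: eval_nat_numeral length_Suc_conv)

lemma length_4_conv: "length xs = 4 \<longleftrightarrow> (\<exists>x y z w. xs = [x, y, z, w])"
  by (auto simp: eval_nat_numeral length_Suc_conv)

text \<open>The default value 0 of \<open>cochain2\<close> on other lengths is what
  \<open>multilinear_map\<close> demands; the rest translates the curried form into lists.\<close>

lemma cochain2_mem:
  assumes "\<And>x. Vector_Spaces.linear (hscale A) (hscale B) (\<lambda>y. g x y)"
    and "\<And>y. Vector_Spaces.linear (hscale A) (hscale B) (\<lambda>x. g x y)"
    and "\<And>x y. twist B (g x y) = g (twist A x) (twist A y)"
  shows "cochain2 g \<in> cochains A B 2"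
  using assms
  by (auto simp: cochains_def multilinear_map_def cochain2_def length_2_conv less_2_cases_iff)

lemma cochain3_mem:
  assumes "\<And>x y. Vector_Spaces.linear (hscale A) (hscale B) (\<lambda>z. g x y z)"
    and "\<And>x z. Vector_Spaces.linear (hscale A) (hscale B) (\<lambda>y. g x y z)"
    and "\<And>y z. Vector_Spaces.linear (hscale A) (hscale B) (\<lambda>x. g x y z)"
    and "\<And>x y z. twist B (g x y z) = g (twist A x) (twist A y) (twist A z)"
  shows "cochain3 g \<in> cochains A B 3"
proof -
  have "i < 3 \<longleftrightarrow> i = 0 \<or> i = 1 \<or> i = 2" for i :: nat by auto
  then show ?thesis
    using assms
    by (auto simp: cochains_def multilinear_map_def cochain3_def length_3_conv)
qed

lemma cochain_2D:
  assumes "f \<in> cochains A B 2"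
  shows "Vector_Spaces.linear (hscale A) (hscale B) (\<lambda>y. f [x, y])"
    and "Vector_Spaces.linear (hscale A) (hscale B) (\<lambda>y. f [y, x])"
    and "twist B (f [x, y]) = f [twist A x, twist A y]"
proof -
  have lin: "Vector_Spaces.linear (hscale A) (hscale B) (\<lambda>x. f (xs[i := x]))"
    if "length xs = 2" "i < 2" for xs i
    using assms that by (simp add: cochains_def multilinear_map_def)
  show "Vector_Spaces.linear (hscale A) (hscale B) (\<lambda>y. f [x, y])"
    "Vector_Spaces.linear (hscale A) (hscale B) (\<lambda>y. f [y, x])"
    using lin[of "[x, x]" 1] lin[of "[x, x]" 0] by simp_all
  show "twist B (f [x, y]) = f [twist A x, twist A y]"
    using assms by (simp add: cochains_def)
qed

lemma cochain_1D:
  assumes "f \<in> cochains A B 1"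
  shows "Vector_Spaces.linear (hscale A) (hscale B) (\<lambda>y. f [y])"
    and "twist B (f [x]) = f [twist A x]"
proof -
  have lin: "Vector_Spaces.linear (hscale A) (hscale B) (\<lambda>x. f (xs[i := x]))"
    if "length xs = 1" "i < 1" for xs i
    using assms that by (simp add: cochains_def multilinear_map_def)
  show "Vector_Spaces.linear (hscale A) (hscale B) (\<lambda>y. f [y])"
    using lin[of "[x]" 0] by simp
  show "twist B (f [x]) = f [twist A x]"
    using assms by (simp add: cochains_def)
qed

lemma vector_space_scale_unit:
  assumes "vector_space s"
  shows "s (- 1) x = - x" "s 1 x = x"
proof -
  interpret vector_space s by fact
  show "s (- 1) x = - x" "s 1 x = x" by simp_all
qed

lemma hom_delta_1:
  assumes "vector_space (hscale B)"
  shows "hom_delta A B \<phi> 1 f [x, y] =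
    hmul B (\<phi> x) (f [y]) - f [hmul A x y] + hmul B (f [x]) (\<phi> y)"
  by (simp add: hom_delta_def vector_space_scale_unit[OF assms])

lemma hom_delta_2:
  assumes "vector_space (hscale B)"
  shows "hom_delta A B \<phi> 2 f [x, y, z] =
    hmul B (\<phi> (twist A x)) (f [y, z]) - f [hmul A x y, twist A z] + f [twist A x, hmul A y z]
    - hmul B (f [x, y]) (\<phi> (twist A z))"
  by (simp add: hom_delta_def vector_space_scale_unit[OF assms] eval_nat_numeral)

lemma hom_delta_3:
  assumes "vector_space (hscale B)"
  shows "hom_delta A B \<phi> 3 f [x, y, z, w] =
    hmul B (\<phi> (twist A (twist A x))) (f [y, z, w]) - f [hmul A x y, twist A z, twist A w]
    + f [twist A x, hmul A y z, twist A w] - f [twist A x, twist A y, hmul A z w]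
    + hmul B (f [x, y, z]) (\<phi> (twist A (twist A w)))"
  by (simp add: hom_delta_def vector_space_scale_unit[OF assms] eval_nat_numeral)


section \<open>Deformation equations of orders one and two\<close>

lemma sum_pairs:
  fixes F :: "nat \<times> nat \<Rightarrow> 'a::comm_monoid_add"
  shows "(\<Sum>x \<in> {(i, j). i + j = 1}. F x) = F (0, 1) + F (1, 0)"
    and "(\<Sum>x \<in> {(i, j). i + j = 2}. F x) = F (0, 2) + F (1, 1) + F (2, 0)"
proof -
  have "{(i, j). i + j = (1::nat)} = {(0, 1), (1, 0)}"
    "{(i, j). i + j = (2::nat)} = {(0, 2), (1, 1), (2, 0)}"
    by auto
  then show "(\<Sum>x \<in> {(i, j). i + j = 1}. F x) = F (0, 1) + F (1, 0)"
    "(\<Sum>x \<in> {(i, j). i + j = 2}. F x) = F (0, 2) + F (1, 1) + F (2, 0)"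
    by (simp_all add: add.assoc)
qed

lemma sum_triples:
  fixes F :: "nat \<times> nat \<times> nat \<Rightarrow> 'a::comm_monoid_add"
  shows "(\<Sum>x \<in> {(i, j, k). i + j + k = 1}. F x) = F (1, 0, 0) + F (0, 1, 0) + F (0, 0, 1)"
    and "(\<Sum>x \<in> {(i, j, k). i + j + k = 2}. F x) =
      F (2, 0, 0) + F (0, 2, 0) + F (0, 0, 2) + F (1, 1, 0) + F (1, 0, 1) + F (0, 1, 1)"
proof -
  have "i + j + k = 1 \<longleftrightarrow> (i, j, k) \<in> {(1, 0, 0), (0, 1, 0), (0, 0, 1)}"
    "i + j + k = 2 \<longleftrightarrow>
      (i, j, k) \<in> {(2, 0, 0), (0, 2, 0), (0, 0, 2), (1, 1, 0), (1, 0, 1), (0, 1, 1)}" for i j k :: nat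
    by (cases i; cases j; cases k; simp add: numeral_2_eq_2 add_is_1; fail)+
  then have "{(i, j, k). i + j + k = (1::nat)} = {(1, 0, 0), (0, 1, 0), (0, 0, 1)}"
    "{(i, j, k). i + j + k = (2::nat)} =
      {(2, 0, 0), (0, 2, 0), (0, 0, 2), (1, 1, 0), (1, 0, 1), (0, 1, 1)}"
    by (simp_all only: set_eq_iff split_paired_all split_paired_All mem_Collect_eq prod.case simp_thms)
  then show "(\<Sum>x \<in> {(i, j, k). i + j + k = 1}. F x) = F (1, 0, 0) + F (0, 1, 0) + F (0, 0, 1)"
    "(\<Sum>x \<in> {(i, j, k). i + j + k = 2}. F x) =
      F (2, 0, 0) + F (0, 2, 0) + F (0, 0, 2) + F (1, 1, 0) + F (1, 0, 1) + F (0, 1, 1)"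
    by (simp_all add: add.assoc)
qed

lemma mult_deformation_1D:
  assumes "mult_deformation A 1 m"
  shows "m 0 = hmul A" "bilinear_op A (m 1)" "twist A (m 1 x y) = m 1 (twist A x) (twist A y)"
    and "hom_associator (twist A) (hmul A) (m 1) x y z
      + hom_associator (twist A) (m 1) (hmul A) x y z = 0"
proof -
  show 0: "m 0 = hmul A" and "bilinear_op A (m 1)"
    and "twist A (m 1 x y) = m 1 (twist A x) (twist A y)"
    using assms by (auto simp: mult_deformation_def)
  have "(\<Sum>(i, j) \<in> {(i, j). i + j = 1}.
      m i (m j x y) (twist A z) - m i (twist A x) (m j y z)) = 0"
    using assms unfolding mult_deformation_def by blast
  then show "hom_associator (twist A) (hmul A) (m 1) x y z
      + hom_associator (twist A) (m 1) (hmul A) x y z = 0"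
    by (simp only: sum_pairs hom_associator_def 0 prod.case)
qed

text \<open>In the order-two equation the index pairs (0, 2) and (2, 0) contribute minus the
  differential of \<open>f\<close>, and (1, 1) contributes the associator of \<open>m 1\<close>. So
  \<open>f\<close> must be a primitive of that associator, with positive sign.\<close>

lemma mult_deformation_extend:
  assumes m: "mult_deformation A 1 m"
    and "vector_space (hscale A)"
    and f: "f \<in> cochains A A 2"
    and delta: "\<And>x y z. hom_delta A A id 2 f [x, y, z] = hom_associator (twist A) (m 1) (m 1) x y z"
  shows "mult_deformation A 2 (m(2 := \<lambda>x y. f [x, y]))" (is "mult_deformation A 2 ?m")
proof -
  \<comment> \<open>Equations of order at most 1 never reach the index 2, so they are inherited from
    \<open>m\<close>.\<close>
  have old: "?m i = m i" if "i \<le> 1" for i using that by simp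
  have "(\<Sum>(i, j) \<in> {(i, j). i + j = n}.
      ?m i (?m j x y) (twist A z) - ?m i (twist A x) (?m j y z)) = 0" if "n \<le> 2" for n x y z
  proof (cases "n \<le> 1")
    case True
    have "(\<Sum>(i, j) \<in> {(i, j). i + j = n}.
        ?m i (?m j x y) (twist A z) - ?m i (twist A x) (?m j y z)) =
      (\<Sum>(i, j) \<in> {(i, j). i + j = n}.
        m i (m j x y) (twist A z) - m i (twist A x) (m j y z))"
      using True by (intro sum.cong) auto
    also have "\<dots> = 0"
      using m True unfolding mult_deformation_def by blast
    finally show ?thesis .
  next
    case False
    with that have "n = 2" by simp
    then show ?thesis
      using delta[of x y z] mult_deformation_1D(1)[OF m]
      by (simp add: sum_pairs hom_delta_2[OF assms(2)] hom_associator_def algebra_simps)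
  qed
  moreover have "bilinear_op A (?m i) \<and> (\<forall>x y. twist A (?m i x y) = ?m i (twist A x) (twist A y))"
    if "i \<le> 2" for i
  proof (cases "i = 2")
    case True
    then show ?thesis using cochain_2D[OF f] by (simp add: bilinear_op_def)
  next
    case False
    with that have "i \<le> 1" by simp
    then show ?thesis using m by (simp add: mult_deformation_def)
  qed
  ultimately show ?thesis
    using m by (simp add: mult_deformation_def)
qed

section \<open>The obstructions are cochains\<close>

lemma linear_fun_comp:
  assumes "Vector_Spaces.linear r s f" "Vector_Spaces.linear s t g"
  shows "Vector_Spaces.linear r t (\<lambda>x. g (f x))"
  using assms by (simp add: Vector_Spaces.linear_iff)

lemma linear_fun_add:
  assumes "Vector_Spaces.linear s t f" "Vector_Spaces.linear s t g"
  shows "Vector_Spaces.linear s t (\<lambda>x. f x + g x)"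
proof -
  interpret vector_space t using assms by (simp add: Vector_Spaces.linear_iff)
  show ?thesis
    using assms by (simp add: Vector_Spaces.linear_iff scale_right_distrib)
qed

lemma linear_fun_diff:
  assumes "Vector_Spaces.linear s t f" "Vector_Spaces.linear s t g"
  shows "Vector_Spaces.linear s t (\<lambda>x. f x - g x)"
proof -
  interpret vector_space t using assms by (simp add: Vector_Spaces.linear_iff)
  show ?thesis
    using assms by (simp add: Vector_Spaces.linear_iff scale_right_diff_distrib)
qed

text \<open>The inner map \<open>f\<close> is arbitrary, so that nested products can be peeled off
  one factor at a time.\<close>

lemma bilinear_op_comp:
  assumes "bilinear_op A m"
  shows "Vector_Spaces.linear s (hscale A) f \<Longrightarrow> Vector_Spaces.linear s (hscale A) (\<lambda>x. m (f x) y)"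
    and "Vector_Spaces.linear s (hscale A) f \<Longrightarrow> Vector_Spaces.linear s (hscale A) (\<lambda>x. m y (f x))"
proof -
  have lin: "Vector_Spaces.linear (hscale A) (hscale A) (\<lambda>x. m x y)"
    "Vector_Spaces.linear (hscale A) (hscale A) (\<lambda>x. m y x)"
    using assms by (auto simp: bilinear_op_def)
  show "Vector_Spaces.linear s (hscale A) (\<lambda>x. m (f x) y)"
    if "Vector_Spaces.linear s (hscale A) f"
    by (rule linear_fun_comp[OF that lin(1)])
  show "Vector_Spaces.linear s (hscale A) (\<lambda>x. m y (f x))"
    if "Vector_Spaces.linear s (hscale A) f"
    by (rule linear_fun_comp[OF that lin(2)])
qed

lemma bilinear_opD:
  assumes "bilinear_op A m"
  shows "Vector_Spaces.linear (hscale A) (hscale A) (m x)"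
    and "Vector_Spaces.linear (hscale A) (hscale A) (\<lambda>x. m x y)"
  using assms by (auto simp: bilinear_op_def)

lemma hom_associator_cochain:
  assumes "bilinear_op A m" "Vector_Spaces.linear (hscale A) (hscale A) (twist A)"
    and "\<And>x y. twist A (m x y) = m (twist A x) (twist A y)"
  shows "cochain3 (hom_associator (twist A) m m) \<in> cochains A A 3"
proof (rule cochain3_mem)
  note lin = linear_fun_diff bilinear_op_comp[OF assms(1)] bilinear_opD[OF assms(1)] assms(2)
  fix x y z
  show "Vector_Spaces.linear (hscale A) (hscale A) (\<lambda>z. hom_associator (twist A) m m x y z)"
    unfolding hom_associator_def by (intro lin)
  show "Vector_Spaces.linear (hscale A) (hscale A) (\<lambda>y. hom_associator (twist A) m m x y z)"
    unfolding hom_associator_def by (intro lin)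
  show "Vector_Spaces.linear (hscale A) (hscale A) (\<lambda>x. hom_associator (twist A) m m x y z)"
    unfolding hom_associator_def by (intro lin)
  show "twist A (hom_associator (twist A) m m x y z)
      = hom_associator (twist A) m m (twist A x) (twist A y) (twist A z)"
    by (simp add: hom_associator_def assms(3) additive.diff[OF linear_additive[OF assms(2)]])
qed

lemma morphism_obstruction_cochain:
  assumes "bilinear_op A m" "bilinear_op B \<nu>" "bilinear_op B n"
    and "Vector_Spaces.linear (hscale A) (hscale B) \<phi>" "Vector_Spaces.linear (hscale A) (hscale B) p"
    and "Vector_Spaces.linear (hscale B) (hscale B) (twist B)"
    and "\<And>x y. twist A (m x y) = m (twist A x) (twist A y)"
    and "\<And>x y. twist B (\<nu> x y) = \<nu> (twist B x) (twist B y)"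
    and "\<And>x y. twist B (n x y) = n (twist B x) (twist B y)"
    and "\<And>x. \<phi> (twist A x) = twist B (\<phi> x)" "\<And>x. p (twist A x) = twist B (p x)"
  shows "cochain2 (morphism_obstruction m \<nu> n \<phi> p) \<in> cochains A B 2"
proof (rule cochain2_mem)
  \<comment> \<open>In \<open>p (m a b)\<close> a linear map stands outside a product; its
    composition rule is instantiated with both partial maps of \<open>m\<close> to fix the inner
    function.\<close>
  note lin = linear_fun_add linear_fun_diff bilinear_op_comp[OF assms(2)] bilinear_op_comp[OF assms(3)]
    linear_fun_comp[OF _ assms(5), where f = "\<lambda>x. m x y" for y] linear_fun_comp[OF _ assms(5), where f = "m x" for x]
    bilinear_opD[OF assms(1)] assms(4,5)
  fix x y
  show "Vector_Spaces.linear (hscale A) (hscale B) (\<lambda>y. morphism_obstruction m \<nu> n \<phi> p x y)"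
    unfolding morphism_obstruction_def by (intro lin)
  show "Vector_Spaces.linear (hscale A) (hscale B) (\<lambda>x. morphism_obstruction m \<nu> n \<phi> p x y)"
    unfolding morphism_obstruction_def by (intro lin)
  show "twist B (morphism_obstruction m \<nu> n \<phi> p x y)
      = morphism_obstruction m \<nu> n \<phi> p (twist A x) (twist A y)"
    using additive.diff[OF linear_additive[OF assms(6)]] additive.add[OF linear_additive[OF assms(6)]]
    by (simp add: morphism_obstruction_def assms(8-10) assms(11)[symmetric] assms(7)[symmetric])
qed

section \<open>Vanishing cohomology and the cocycle condition\<close>

lemma zero_mem_cochains:
  assumes "Vector_Spaces.linear (hscale A) (hscale B) \<phi>"
    and "Vector_Spaces.linear (hscale B) (hscale B) (twist B)"
  shows "0 \<in> cochains A B n"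
proof -
  \<comment> \<open>The zero map is written as \<open>\<phi>\<close> minus itself; linearity of
    \<open>\<phi>\<close> also supplies the two vector spaces.\<close>
  have "Vector_Spaces.linear (hscale A) (hscale B) (\<lambda>x. 0)"
    using linear_fun_diff[OF assms(1) assms(1)] by simp
  then show ?thesis
    using additive.zero[OF linear_additive[OF assms(2)]]
    by (simp add: cochains_def multilinear_map_def zero_fun_def)
qed

lemma hom_delta_zero:
  assumes "vector_space (hscale B)" "biadditive (hmul B)"
  shows "hom_delta A B \<phi> n 0 = 0"
proof -
  interpret vector_space "hscale B" by fact
  show ?thesis
    by (simp add: fun_eq_iff hom_delta_def biadditiveD[OF assms(2)])
qed

lemma hom_alg_morphismD:
  assumes "hom_alg_morphism A B \<phi>"
  shows "Vector_Spaces.linear (hscale A) (hscale B) \<phi>"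
    and "\<phi> (hmul A x y) = hmul B (\<phi> x) (\<phi> y)" and "\<phi> (twist A x) = twist B (\<phi> x)"
  using assms by (auto simp: hom_alg_morphism_def fun_eq_iff)

lemma hom_associativeD:
  assumes "hom_associative A"
  shows "vector_space (hscale A)" "bilinear_op A (hmul A)"
    and "Vector_Spaces.linear (hscale A) (hscale A) (twist A)"
    and "hom_associator (twist A) (hmul A) (hmul A) x y z = 0"
  using assms by (auto simp: hom_associative_def hom_associator_def)

text \<open>Vanishing is an equation between sets of cosets. Since 0 is a coboundary,
  \<open>z\<close> lies in its own coset, and that coset must be the set of coboundaries.\<close>

lemma cocycle_is_coboundary:
  assumes "hom_associative A" "hom_associative B" "hom_alg_morphism A B \<phi>"
    and van: "mor_cohomology_vanishes A B \<phi> n"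
    and z: "z \<in> mor_cocycles A B \<phi> n"
  shows "z \<in> mor_coboundaries A B \<phi> n"
proof -
  note A = hom_associativeD[OF assms(1)] and B = hom_associativeD[OF assms(2)]
    and phi = hom_alg_morphismD[OF assms(3)]
  have id: "Vector_Spaces.linear (hscale A) (hscale A) (\<lambda>x. x)"
    "Vector_Spaces.linear (hscale B) (hscale B) (\<lambda>x. x)"
    using A(1) B(1) by (simp_all add: Vector_Spaces.linear_iff)
  have "0 \<in> mor_cochains A B (n - 1)"
    using zero_mem_cochains[OF id(1) A(3)] zero_mem_cochains[OF id(2) B(3)]
      zero_mem_cochains[OF phi(1) B(3)]
    by (simp add: mor_cochains_def zero_prod_def)
  moreover have "mor_delta A B \<phi> (n - 1) 0 = 0"
    using A(1,2) B(1,2) additive.zero[OF linear_additive[OF phi(1)]]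
    by (simp add: mor_delta_def zero_prod_def hom_delta_zero bilinear_op_biadditive)
      (simp add: fun_eq_iff)
  ultimately have "0 \<in> mor_coboundaries A B \<phi> n"
    unfolding mor_coboundaries_def by (metis imageI)
  then have "z + 0 \<in> z +o mor_coboundaries A B \<phi> n"
    by (rule set_plus_intro2)
  also have "z +o mor_coboundaries A B \<phi> n \<in> mor_cohomology A B \<phi> n"
    using z by (simp add: mor_cohomology_def)
  then have "z +o mor_coboundaries A B \<phi> n = mor_coboundaries A B \<phi> n"
    using van by (simp add: mor_cohomology_vanishes_def)
  finally show ?thesis by simp
qed

text \<open>Used for both algebras, this gives the first two components of the cocycle
  condition.\<close>

lemma hom_associator_hom_delta:
  assumes "hom_associative A" "multiplicative A" "mult_deformation A 1 m"
  shows "hom_delta A A id 3 (cochain3 (hom_associator (twist A) (m 1) (m 1))) = 0"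
proof
  fix xs :: "'b list"
  note A = hom_associativeD[OF assms(1)] and m = mult_deformation_1D[OF assms(3)]
  show "hom_delta A A id 3 (cochain3 (hom_associator (twist A) (m 1) (m 1))) xs = 0 xs"
  proof (cases "length xs = 4")
    case True
    then obtain x y z w where xs: "xs = [x, y, z, w]" by (auto simp: length_4_conv)
    have mult: "twist A (hmul A x y) = hmul A (twist A x) (twist A y)" for x y
      using assms(2) by (simp add: multiplicative_def)
    show ?thesis
      using hom_associator_cocycle[OF bilinear_op_biadditive[OF A(2)] bilinear_op_biadditive[OF m(2)]
          mult m(3) m(4), of x y z w]
      by (simp add: xs hom_delta_3 A(1) cochain3_def)
  next
    case False
    then show ?thesis by (simp add: hom_delta_def)
  qed
qed

section \<open>The obstruction triple and the extension to order two\<close>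

theorem corollary4p4:
  fixes A :: "('k::{alg_closed_field, field_char_0}, 'a::ab_group_add) hom_alg"
    and B :: "('k, 'b::ab_group_add) hom_alg"
    and \<phi> :: "'a \<Rightarrow> 'b"
  assumes "hom_associative A" and "multiplicative A"
    and "hom_associative B" and "multiplicative B"
    and "hom_alg_morphism A B \<phi>"
    and "mor_cohomology_vanishes A B \<phi> 3"
  shows "\<forall>\<Theta>. infinitesimal_deformation A B \<phi> \<Theta> \<longrightarrow>
           (\<exists>N' \<Theta>'. is_extension A B \<phi> 1 \<Theta> N' \<Theta>')"
proof (intro allI impI)
  fix \<Theta> assume "infinitesimal_deformation A B \<phi> \<Theta>"
  then obtain m n p where \<Theta>: "\<Theta> = (m, n, p)" and def1: "deformation A B \<phi> 1 (m, n, p)"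
    by (cases \<Theta>) (auto simp: infinitesimal_deformation_def)
  note A = hom_associativeD[OF assms(1)] and B = hom_associativeD[OF assms(3)]
    and phi = hom_alg_morphismD[OF assms(5)]
  have multB: "twist B (hmul B x y) = hmul B (twist B x) (twist B y)" for x y
    using assms(4) by (simp add: multiplicative_def)
  have defm: "mult_deformation A 1 m" and defn: "mult_deformation B 1 n"
    and p0: "p 0 = \<phi>"
    using def1 by (auto simp: deformation_def)
  have p_high: "p i = 0" if "i > 1" for i
    using def1 that by (auto simp: deformation_def)
  note m = mult_deformation_1D[OF defm] and n = mult_deformation_1D[OF defn]
  have linp: "Vector_Spaces.linear (hscale A) (hscale B) (p i) \<and> p i \<circ> twist A = twist B \<circ> p i"
    if "i \<le> 1" for i
    using def1 that by (auto simp: deformation_def)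
  then have p: "Vector_Spaces.linear (hscale A) (hscale B) (p 1)" "p 1 (twist A x) = twist B (p 1 x)" for x
    by (auto simp: fun_eq_iff)
  have defp: "(\<Sum>i = 0..k. p i (m (k - i) a b)) =
      (\<Sum>(i, j, l) \<in> {(i, j, l). i + j + l = k}. n i (p j a) (p l b))" if "k \<le> 1" for k a b
    using def1 that unfolding deformation_def by blast
  have firstp: "\<phi> (m 1 a b) + p 1 (hmul A a b)
      = n 1 (\<phi> a) (\<phi> b) + hmul B (p 1 a) (\<phi> b) + hmul B (\<phi> a) (p 1 b)" for a b
    using defp[of 1 a b, unfolded sum_triples] by (simp add: m(1) n(1) p0)
  \<comment> \<open>Signs are chosen so that the second-order terms have to satisfy \<delta>(f, g,
    h) = (ObA, ObB, Ob) without further sign.\<close>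
  define ObA where "ObA = hom_associator (twist A) (m 1) (m 1)"
  define ObB where "ObB = hom_associator (twist B) (n 1) (n 1)"
  define Ob where "Ob = morphism_obstruction (m 1) (hmul B) (n 1) \<phi> (p 1)"
  \<comment> \<open>The third component of \<open>mor_delta\<close> in degree 3, hence
    \<open>hom_delta\<close> in degree 2. On lists of length other than 3 every term is 0.\<close>
  have "(\<phi> \<circ> cochain3 ObA) - (cochain3 ObB \<circ> map \<phi>) - hom_delta A B \<phi> 2 (cochain2 Ob) = 0"
  proof
    fix xs
    show "((\<phi> \<circ> cochain3 ObA) - (cochain3 ObB \<circ> map \<phi>) - hom_delta A B \<phi> 2 (cochain2 Ob)) xs = 0 xs"
    proof (cases "length xs = 3")
      case True
      then obtain x y z where xs: "xs = [x, y, z]" by (auto simp: length_3_conv)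
      have "\<phi> (ObA x y z) - ObB (\<phi> x) (\<phi> y) (\<phi> z) = hmul B (\<phi> (twist A x)) (Ob y z)
          - Ob (hmul A x y) (twist A z) + Ob (twist A x) (hmul A y z) - hmul B (Ob x y) (\<phi> (twist A z))"
        unfolding ObA_def ObB_def Ob_def
        by (rule morphism_obstruction_cocycle[where \<alpha> = "twist A" and \<beta> = "twist B" and \<phi> = \<phi>
              and p = "p 1" and \<mu> = "hmul A" and m = "m 1" and \<nu> = "hmul B" and n = "n 1",
            OF bilinear_op_biadditive[OF B(2)] bilinear_op_biadditive[OF n(2)]
              linear_additive[OF phi(1)] linear_additive[OF p(1)] phi(3) p(2) phi(2) B(4) m(4) n(4)
              firstp])
      then show ?thesis
        by (simp add: xs hom_delta_2 B(1) cochain2_def cochain3_def)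
    next
      case False
      then show ?thesis
        using additive.zero[OF linear_additive[OF phi(1)]]
        by (simp add: hom_delta_def cochain3_def)
    qed
  qed
  then have "mor_delta A B \<phi> 3 (cochain3 ObA, cochain3 ObB, cochain2 Ob) = 0"
    using hom_associator_hom_delta[OF assms(1,2) defm] hom_associator_hom_delta[OF assms(3,4) defn]
    by (simp add: mor_delta_def zero_prod_def ObA_def ObB_def)
  moreover have "cochain3 ObA \<in> cochains A A 3" "cochain3 ObB \<in> cochains B B 3"
    unfolding ObA_def ObB_def by (intro hom_associator_cochain m n A B)+
  moreover have "cochain2 Ob \<in> cochains A B 2"
    unfolding Ob_def by (intro morphism_obstruction_cochain m n A B phi p multB)
  \<comment> \<open>Here the hypothesis on cohomology enters.\<close>
  ultimately have "(cochain3 ObA, cochain3 ObB, cochain2 Ob) \<in> mor_coboundaries A B \<phi> 3"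
    by (intro cocycle_is_coboundary assms) (simp add: mor_cocycles_def mor_cochains_def)
  \<comment> \<open>The primitive has degree 2 in the complex of \<open>\<phi>\<close>, so its third
    component \<open>h\<close> takes lists of length 1 and can serve as the
    \<open>t^2\<close>-coefficient of the morphism.\<close>
  then obtain f g h where f: "f \<in> cochains A A 2" and g: "g \<in> cochains B B 2"
    and h: "h \<in> cochains A B 1"
    and delta: "hom_delta A A id 2 f = cochain3 ObA" "hom_delta B B id 2 g = cochain3 ObB"
      "(\<phi> \<circ> f) - (g \<circ> map \<phi>) - hom_delta A B \<phi> 1 h = cochain2 Ob"
    by (auto simp: mor_coboundaries_def mor_cochains_def mor_delta_def)
  \<comment> \<open>Only the index 2 changes: orders 0 and 1 are kept, and coefficients beyond 2
    stay 0.\<close>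
  let ?m = "m(2 := \<lambda>x y. f [x, y])" and ?n = "n(2 := \<lambda>x y. g [x, y])" and ?p = "p(2 := \<lambda>x. h [x])"
  have "mult_deformation A 2 ?m"
    by (rule mult_deformation_extend[OF defm A(1) f]) (simp add: delta cochain3_def ObA_def)
  moreover have "mult_deformation B 2 ?n"
    by (rule mult_deformation_extend[OF defn B(1) g]) (simp add: delta cochain3_def ObB_def)
  moreover have "Vector_Spaces.linear (hscale A) (hscale B) (?p i) \<and> ?p i \<circ> twist A = twist B \<circ> ?p i"
    if "i \<le> 2" for i
    using that linp[of i] cochain_1D[OF h] by (auto simp: fun_eq_iff)
  moreover have "(\<Sum>i = 0..k. ?p i (?m (k - i) a b)) =
      (\<Sum>(i, j, l) \<in> {(i, j, l). i + j + l = k}. ?n i (?p j a) (?p l b))" if "k \<le> 2" for k a b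
  proof (cases "k \<le> 1")
    case True
    have "(\<Sum>i = 0..k. ?p i (?m (k - i) a b)) = (\<Sum>i = 0..k. p i (m (k - i) a b))"
      using True by (intro sum.cong) auto
    also have "\<dots> = (\<Sum>(i, j, l) \<in> {(i, j, l). i + j + l = k}. n i (p j a) (p l b))"
      using True by (rule defp)
    also have "\<dots> = (\<Sum>(i, j, l) \<in> {(i, j, l). i + j + l = k}. ?n i (?p j a) (?p l b))"
      using True by (intro sum.cong) auto
    finally show ?thesis .
  next
    case False
    with that have k: "k = 2" by simp
    have "\<phi> (f [a, b]) - g [\<phi> a, \<phi> b] - hom_delta A B \<phi> 1 h [a, b] = Ob a b"
      using fun_cong[OF delta(3), of "[a, b]"] by (simp add: cochain2_def)
    moreover have "(\<Sum>i = 0..2. F i) = F 0 + F 1 + F 2" for F :: "nat \<Rightarrow> 'b"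
      by (simp add: numeral_2_eq_2)
    ultimately show ?thesis
      \<comment> \<open>Of the six index triples with sum 2, those containing a 2 give the terms in
        \<open>g\<close> and \<open>h\<close>; the other three, with \<open>p 1 (m 1 a b)\<close>
        from the left side, make up \<open>Ob a b\<close>.\<close>
      unfolding k sum_triples hom_delta_1[OF B(1)]
      by (simp add: m(1) n(1) p0 Ob_def morphism_obstruction_def algebra_simps)
  qed
  ultimately have "deformation A B \<phi> 2 (?m, ?n, ?p)"
    using p0 p_high by (simp add: deformation_def)
  then have "is_extension A B \<phi> 1 \<Theta> 2 (?m, ?n, ?p)"
    by (simp add: is_extension_def \<Theta>)
  then show "\<exists>N' \<Theta>'. is_extension A B \<phi> 1 \<Theta> N' \<Theta>'" by blast
qed

end
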